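(* Let $G$ be a simple complete bipartite graph with partite sets $(A,B)$, and let $R\subseteq V(G)$ be a set of terminals with $|R|\ge 2$. Then: (1) if $R\subseteq A$, a maximum $R$-IDST of $G$ has size exactly $|B|$ (symmetrically, if $R\subseteq B$, it has size $|A|$); (2) otherwise, if $|R\cap A|=1$ and $|R\cap B|>0$, a maximum $R$-IDST has size exactly $\min(|A|,|B|+1)$ (symmetrically, if $|R\cap B|=1$ and $|R\cap A|>0$, it has size $\min(|B|,|A|+1)$); (3) otherwise, if $|R\cap A|>1$ and $|R\cap B|>1$, a maximum $R$-IDST has size exactly $\min(|A|,|B|)$.
   Context: For a tree $T$, $\mathrm{int}(T)$ is the set of vertices of degree at least 2 in $T$ and $L(T)$ the set of leaves. For $R\subseteq V(G)$, an $R$-Steiner tree is a subtree $T$ of $G$ with $R\subseteq V(T)$ and $L(T)\subseteq R$. An $R$-IDST of a simple graph $G$ is a set $\{T_1,\dots,T_k\}$ of $R$-Steiner trees of $G$ such that $\mathrm{int}(T_i)\cap\mathrm{int}(T_j)=\emptyset$ for all distinct $i,j$; its size is $k$.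
   Formalization: If |R∩A|=|R∩B|=1, the two values in (2) conflict when |A|≠|B| (A={a,a'}, B={b}, R={a,b}: the maximum is 1, not 2); there min(|A|,|B|+1) is claimed only if |A|≤|B|, and min(|B|,|A|+1) only if |B|≤|A|. *)

theory Defs
  imports Main
begin

record 'a graph =
  verts :: "'a set"
  edges :: "'a set set"

definition simple_graph :: "'a graph \<Rightarrow> bool" where
  "simple_graph G \<longleftrightarrow> (\<forall>e \<in> edges G. e \<subseteq> verts G \<and> card e = 2)"

definition subgraph :: "'a graph \<Rightarrow> 'a graph \<Rightarrow> bool" where
  "subgraph H G \<longleftrightarrow> simple_graph H \<and> verts H \<subseteq> verts G \<and> edges H \<subseteq> edges G"

definition degree :: "'a graph \<Rightarrow> 'a \<Rightarrow> nat" where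
  "degree G v = card {e \<in> edges G. v \<in> e}"

definition walk :: "'a graph \<Rightarrow> 'a list \<Rightarrow> bool" where
  "walk G p \<longleftrightarrow> p \<noteq> [] \<and> set p \<subseteq> verts G \<and> successively (\<lambda>u v. {u, v} \<in> edges G) p"

definition connected_graph :: "'a graph \<Rightarrow> bool" where
  "connected_graph G \<longleftrightarrow> verts G \<noteq> {} \<and>
     (\<forall>u \<in> verts G. \<forall>v \<in> verts G. \<exists>p. walk G p \<and> hd p = u \<and> last p = v)"

text \<open>A cycle is given by its vertices in order, without repeating the starting vertex.\<close>

definition cycle :: "'a graph \<Rightarrow> 'a list \<Rightarrow> bool" where
  "cycle G p \<longleftrightarrow> walk G p \<and> distinct p \<and> length p \<ge> 3 \<and> {last p, hd p} \<in> edges G"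

definition tree :: "'a graph \<Rightarrow> bool" where
  "tree T \<longleftrightarrow> simple_graph T \<and> connected_graph T \<and> (\<nexists>p. cycle T p)"

definition int_verts :: "'a graph \<Rightarrow> 'a set" where
  "int_verts T = {v \<in> verts T. degree T v \<ge> 2}"

definition leaves :: "'a graph \<Rightarrow> 'a set" where
  "leaves T = {v \<in> verts T. degree T v = 1}"

definition steiner_tree :: "'a graph \<Rightarrow> 'a set \<Rightarrow> 'a graph \<Rightarrow> bool" where
  "steiner_tree G R T \<longleftrightarrow> tree T \<and> subgraph T G \<and> R \<subseteq> verts T \<and> leaves T \<subseteq> R"

text \<open>An IDST is a set of trees, so a tree without internal vertices (a single edge) can occur
  in it only once.\<close>

definition IDST :: "'a graph \<Rightarrow> 'a set \<Rightarrow> 'a graph set \<Rightarrow> bool" where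
  "IDST G R \<T> \<longleftrightarrow> finite \<T> \<and> (\<forall>T \<in> \<T>. steiner_tree G R T) \<and>
     (\<forall>T \<in> \<T>. \<forall>T' \<in> \<T>. T \<noteq> T' \<longrightarrow> int_verts T \<inter> int_verts T' = {})"

definition max_IDST_size :: "'a graph \<Rightarrow> 'a set \<Rightarrow> nat \<Rightarrow> bool" where
  "max_IDST_size G R k \<longleftrightarrow>
     (\<exists>\<T>. IDST G R \<T> \<and> card \<T> = k) \<and> (\<forall>\<T>. IDST G R \<T> \<longrightarrow> card \<T> \<le> k)"

definition complete_bipartite :: "'a graph \<Rightarrow> 'a set \<Rightarrow> 'a set \<Rightarrow> bool" where
  "complete_bipartite G A B \<longleftrightarrow> A \<inter> B = {} \<and> verts G = A \<union> B \<and>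
     edges G = {{a, b} | a b. a \<in> A \<and> b \<in> B}"

end

theory Submission
  imports Defs
begin

text \<open>Upper bounds: a Steiner tree with two terminals on one side has an internal vertex on the
  other side, and internal vertices of distinct trees are distinct. If \<open>r\<close> is the only terminal
  in \<open>A\<close>, then a tree avoiding internal vertices in \<open>B\<close>, or in \<open>A - {r}\<close>, is the star joining
  \<open>r\<close> to the terminals in \<open>B\<close>, so at most one tree of the family escapes the count.

  Lower bounds: every extremal tree is a double star, in which \<open>a \<in> A\<close> is joined to \<open>b\<close>
  and all terminals in \<open>B\<close>, and \<open>b \<in> B\<close> to \<open>a\<close> and all terminals in \<open>A\<close>. Its internal vertices
  lie in \<open>{a, b}\<close>, so one lets \<open>(a, b)\<close> run over a matching.\<close>

section \<open>Degrees, cycles and connectedness\<close>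

lemma simple_graph_edgeE:
  assumes "simple_graph T" "e \<in> edges T" "v \<in> e"
  obtains u where "e = {v, u}" "u \<noteq> v" "u \<in> verts T" "v \<in> verts T"
proof -
  have "card e = 2" "e \<subseteq> verts T" using assms by (auto simp: simple_graph_def)
  then show ?thesis using assms(3) that by (auto simp: card_2_iff)
qed

text \<open>Distinct edges at \<open>v\<close> have distinct other ends, so counting edges becomes
  finding two neighbours. Finiteness matters because \<open>card\<close> of an infinite set is
  0.\<close>

lemma degree_ge_2_iff:
  assumes "simple_graph T" "finite (edges T)"
  shows "2 \<le> degree T v \<longleftrightarrow> (\<exists>u w. u \<noteq> w \<and> {v, u} \<in> edges T \<and> {v, w} \<in> edges T)"
proof -
  have fin: "finite {e \<in> edges T. v \<in> e}" using assms by simp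
  have "2 \<le> degree T v \<longleftrightarrow> \<not> card {e \<in> edges T. v \<in> e} \<le> Suc 0"
    by (auto simp: degree_def)
  also have "\<dots> \<longleftrightarrow> (\<exists>e f. e \<in> edges T \<and> f \<in> edges T \<and> v \<in> e \<and> v \<in> f \<and> e \<noteq> f)"
    unfolding card_le_Suc0_iff_eq[OF fin] by blast
  also have "\<dots> \<longleftrightarrow> (\<exists>u w. u \<noteq> w \<and> {v, u} \<in> edges T \<and> {v, w} \<in> edges T)"
    (is "?L \<longleftrightarrow> ?R")
  proof
    assume ?L
    then obtain e f where ef: "e \<in> edges T" "f \<in> edges T" "v \<in> e" "v \<in> f" "e \<noteq> f" by blast
    obtain u where "e = {v, u}" using simple_graph_edgeE[OF assms(1) ef(1,3)] by blast
    moreover obtain w where "f = {v, w}" using simple_graph_edgeE[OF assms(1) ef(2,4)] by blast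
    ultimately show ?R using ef by blast
  next
    assume ?R
    then show ?L by (metis doubleton_eq_iff insertI1)
  qed
  finally show ?thesis .
qed

lemma int_vertsI:
  assumes "simple_graph T" "finite (edges T)" "{v, u} \<in> edges T" "{v, w} \<in> edges T" "u \<noteq> w"
  shows "v \<in> int_verts T"
proof -
  have "v \<in> verts T" using assms(1,3) by (auto simp: simple_graph_def)
  then show ?thesis
    using assms degree_ge_2_iff[OF assms(1,2)] by (auto simp: int_verts_def)
qed

text \<open>Every vertex of a cycle has its predecessor and its successor as two different
  neighbours. This gives acyclicity of any graph with at most two internal vertices, in particular
  of a double star.\<close>

lemma cycle_three_int_verts:
  assumes "simple_graph T" "finite (edges T)" "cycle T p"
  shows "\<exists>x y z. distinct [x, y, z] \<and> {x, y, z} \<subseteq> int_verts T"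
proof -
  have p: "distinct p" "length p \<ge> 3" "{last p, hd p} \<in> edges T"
    "successively (\<lambda>u v. {u, v} \<in> edges T) p"
    using assms(3) by (auto simp: cycle_def walk_def)
  obtain x y z q where q: "p = x # y # z # q"
    using p(2) by (auto simp: numeral_3_eq_3 Suc_le_length_iff)
  have e: "{x, y} \<in> edges T" "{y, x} \<in> edges T" "{y, z} \<in> edges T" "{z, y} \<in> edges T"
    using p(4) by (auto simp: q insert_commute)
  \<comment> \<open>The predecessor of \<open>x\<close> is \<open>last p\<close>, through the
    closing edge. It lies in \<open>z # q\<close>, hence differs from \<open>y\<close>.\<close>
  have l: "{x, last p} \<in> edges T" "last p \<noteq> y"
    using p(1,3) last_in_set[of "z # q"] by (auto simp: q insert_commute)
  have "y \<in> int_verts T" using int_vertsI[OF assms(1,2) e(2,3)] p(1) by (auto simp: q)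
  moreover have "x \<in> int_verts T" using int_vertsI[OF assms(1,2) e(1) l(1)] l(2) by auto
  moreover have "z \<in> int_verts T"
  \<comment> \<open>The successor of \<open>z\<close> is \<open>x\<close> in a triangle and the head
    of \<open>q\<close> otherwise.\<close>
  proof (cases q)
    case Nil
    then have "{z, x} \<in> edges T" using l(1) by (simp add: q insert_commute)
    then show ?thesis using int_vertsI[OF assms(1,2) e(4)] p(1) by (auto simp: q)
  next
    case (Cons w q')
    then have "{z, w} \<in> edges T" "w \<noteq> y" using p(1,4) by (auto simp: q)
    then show ?thesis using int_vertsI[OF assms(1,2) e(4)] by auto
  qed
  moreover have "distinct [x, y, z]" using p(1) by (simp add: q)
  ultimately show ?thesis by blast
qed

lemma walk_stays_in:
  assumes "walk T p" "hd p \<in> S"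
    and "\<And>u v. u \<in> S \<Longrightarrow> {u, v} \<in> edges T \<Longrightarrow> v \<in> S"
  shows "last p \<in> S"
proof -
  have "p \<noteq> []" "successively (\<lambda>u v. {u, v} \<in> edges T) p"
    using assms(1) by (auto simp: walk_def)
  then show ?thesis using assms(2)
    by (induction p rule: induct_list012) (auto dest: assms(3))
qed

text \<open>Used to trap a whole tree inside one vertex together with its neighbours.\<close>

lemma connected_graph_subset_closed:
  assumes "connected_graph T" "v \<in> S" "v \<in> verts T"
    and "\<And>u w. u \<in> S \<Longrightarrow> {u, w} \<in> edges T \<Longrightarrow> w \<in> S"
  shows "verts T \<subseteq> S"
proof
  fix w assume "w \<in> verts T"
  then obtain p where "walk T p" "hd p = v" "last p = w"
    using assms(1,3) by (auto simp: connected_graph_def)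
  then show "w \<in> S" using walk_stays_in[of T p S] assms(2,4) by blast
qed

text \<open>Adjacency is symmetric, so any two vertices are linked through the root
  \<open>c\<close>; each step of the closure prepends one vertex to a walk.\<close>

lemma connected_graphI_root:
  assumes "simple_graph T" "c \<in> verts T"
    and "\<And>v. v \<in> verts T \<Longrightarrow> (c, v) \<in> {(x, y). {x, y} \<in> edges T}\<^sup>*"
  shows "connected_graph T"
proof -
  let ?r = "{(x, y). {x, y} \<in> edges T}"
  have sym: "sym (?r\<^sup>*)" by (rule sym_rtrancl) (auto simp: sym_def insert_commute)
  have walk: "\<exists>p. walk T p \<and> hd p = u \<and> last p = v" if "(u, v) \<in> ?r\<^sup>*" "v \<in> verts T" for u v
    using that(1)
  proof (induction rule: converse_rtrancl_induct)
    case base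
    then show ?case using that(2) by (intro exI[of _ "[v]"]) (auto simp: walk_def)
  next
    case (step y z)
    then obtain p where p: "walk T p" "hd p = z" "last p = v" by blast
    have "y \<in> verts T" using step(1) assms(1) by (auto simp: simple_graph_def)
    then have "walk T (y # p)" using p step(1) by (auto simp: walk_def successively_Cons)
    then show ?case using p by (intro exI[of _ "y # p"]) (auto simp: walk_def)
  qed
  have "(u, v) \<in> ?r\<^sup>*" if "u \<in> verts T" "v \<in> verts T" for u v
    using symD[OF sym assms(3)[OF that(1)]] assms(3)[OF that(2)] by (rule rtrancl_trans)
  then show ?thesis using walk assms(2) by (auto simp: connected_graph_def)
qed

section \<open>Edges of complete bipartite graphs\<close>

lemma complete_bipartite_commute: "complete_bipartite G A B \<Longrightarrow> complete_bipartite G B A"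
  by (auto simp: complete_bipartite_def insert_commute)

lemma complete_bipartite_edge_iff:
  assumes "complete_bipartite G A B"
  shows "{u, v} \<in> edges G \<longleftrightarrow> u \<in> A \<and> v \<in> B \<or> u \<in> B \<and> v \<in> A"
  using assms by (auto simp: complete_bipartite_def doubleton_eq_iff)

lemma complete_bipartite_edge_sides:
  assumes "complete_bipartite G A B" "edges T \<subseteq> edges G" "{u, v} \<in> edges T"
  shows "u \<in> A \<and> v \<in> B \<and> u \<notin> B \<and> v \<notin> A \<or> u \<in> B \<and> v \<in> A \<and> u \<notin> A \<and> v \<notin> B"
proof -
  have "A \<inter> B = {}" using assms(1) by (simp add: complete_bipartite_def)
  moreover have "{u, v} \<in> edges G" using assms(2,3) by blast
  ultimately show ?thesis unfolding complete_bipartite_edge_iff[OF assms(1)] by blast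
qed

lemma complete_bipartite_finite_edges:
  assumes "complete_bipartite G A B" "finite A" "finite B"
  shows "finite (edges G)"
proof -
  have "edges G = (\<lambda>(a, b). {a, b}) ` (A \<times> B)"
    using assms(1) by (auto simp: complete_bipartite_def)
  then show ?thesis using assms(2,3) by simp
qed

section \<open>Where Steiner trees have internal vertices\<close>

lemma finite_edges_steiner_tree:
  "finite (edges G) \<Longrightarrow> steiner_tree G R T \<Longrightarrow> finite (edges T)"
  by (auto simp: steiner_tree_def subgraph_def intro: finite_subset)

text \<open>A terminal exists and differs from \<open>v\<close>, so connectedness gives
  \<open>v\<close> an edge; and \<open>v\<close> is no leaf, since leaves are terminals. Only degree
  at least 2 remains.\<close>

lemma steiner_tree_nonterminal:
  assumes "steiner_tree G R T" "finite (edges G)" "R \<noteq> {}" "v \<in> verts T" "v \<notin> R"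
  shows "v \<in> int_verts T"
proof -
  have T: "simple_graph T" "connected_graph T" "finite (edges T)" "R \<subseteq> verts T" "leaves T \<subseteq> R"
    using assms(1) finite_edges_steiner_tree[OF assms(2,1)]
    by (auto simp: steiner_tree_def tree_def)
  have "\<not> verts T \<subseteq> {v}" using T(4) assms(3,5) by blast
  then obtain w where w: "{v, w} \<in> edges T"
    using connected_graph_subset_closed[OF T(2), of v "{v}"] assms(4) by blast
  then have "degree T v \<noteq> 0" using T(3) by (auto simp: degree_def)
  moreover have "degree T v \<noteq> 1" using T(5) assms(4,5) by (auto simp: leaves_def)
  ultimately show ?thesis using assms(4) by (auto simp: int_verts_def)
qed

text \<open>If all neighbours of \<open>y\<close> have degree 1, then \<open>y\<close> and its neighbours form a
  connected component.\<close>

lemma steiner_tree_int_verts_meet: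
  assumes G: "complete_bipartite G A B" "finite A" "finite B"
    and T: "steiner_tree G R T" and R: "card (R \<inter> A) > 1"
  shows "int_verts T \<inter> B \<noteq> {}"
proof
  assume no: "int_verts T \<inter> B = {}"
  have T': "simple_graph T" "connected_graph T" "finite (edges T)" "R \<subseteq> verts T"
    "edges T \<subseteq> edges G"
    using T finite_edges_steiner_tree[OF complete_bipartite_finite_edges[OF G] T]
    by (auto simp: steiner_tree_def tree_def subgraph_def)
  obtain x y where xy: "x \<in> R \<inter> A" "y \<in> R \<inter> A" "x \<noteq> y"
    using R card_le_Suc0_iff_eq[of "R \<inter> A"] G(2) by auto
  have "verts T \<subseteq> insert y {b. {y, b} \<in> edges T}"
  proof (rule connected_graph_subset_closed[OF T'(2)])
    fix u w assume u: "u \<in> insert y {b. {y, b} \<in> edges T}" and e: "{u, w} \<in> edges T"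
    show "w \<in> insert y {b. {y, b} \<in> edges T}"
    proof (cases "u = y")
      case True
      then show ?thesis using e by simp
    next
      case False
      then have y: "{u, y} \<in> edges T" using u by (auto simp: insert_commute)
      then have "u \<in> B"
        using complete_bipartite_edge_sides[OF G(1) T'(5)] xy(2) by blast
      then show ?thesis using int_vertsI[OF T'(1,3) y e] no by blast
    qed
  qed (use xy T'(4) in auto)
  then have "{y, x} \<in> edges T" using xy T'(4) by auto
  then show False using complete_bipartite_edge_sides[OF G(1) T'(5)] xy by blast
qed

text \<open>Neighbours of \<open>r\<close> lie in \<open>B\<close> and have no second neighbour, so
  \<open>T\<close> consists of \<open>r\<close> and its neighbours; a nonterminal among these would
  be internal. The conclusion is one fixed graph, so at most one tree of a family can be of this
  kind.\<close>

lemma steiner_tree_star: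
  assumes G: "complete_bipartite G A B" "finite A" "finite B"
    and T: "steiner_tree G R T" and R: "R \<inter> A = {r}" "R \<subseteq> verts G"
    and no: "int_verts T \<inter> B = {}"
  shows "T = \<lparr>verts = R, edges = (\<lambda>y. {r, y}) ` (R \<inter> B)\<rparr>"
proof -
  note fin = complete_bipartite_finite_edges[OF G]
  have T': "simple_graph T" "connected_graph T" "finite (edges T)" "R \<subseteq> verts T"
    "edges T \<subseteq> edges G" "verts T \<subseteq> verts G"
    using T finite_edges_steiner_tree[OF fin T]
    by (auto simp: steiner_tree_def tree_def subgraph_def)
  have r: "r \<in> R" "r \<in> A" "r \<in> verts T" using R(1) T'(4) by auto
  have AB: "A \<inter> B = {}" "verts G = A \<union> B" using G(1) by (auto simp: complete_bipartite_def)
  have bR: "v \<in> R" if "v \<in> verts T" "v \<in> B" for v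
    using steiner_tree_nonterminal[OF T fin _ that(1)] r(1) no that(2) by blast
  note nb = complete_bipartite_edge_sides[OF G(1) T'(5)]
  have sub: "verts T \<subseteq> insert r {b. {r, b} \<in> edges T}"
  proof (rule connected_graph_subset_closed[OF T'(2)])
    fix u w assume u: "u \<in> insert r {b. {r, b} \<in> edges T}" and e: "{u, w} \<in> edges T"
    show "w \<in> insert r {b. {r, b} \<in> edges T}"
    proof (cases "u = r")
      case True
      then show ?thesis using e by simp
    next
      case False
      then have y: "{u, r} \<in> edges T" using u by (auto simp: insert_commute)
      then have "u \<in> B" using nb r(2) by blast
      then show ?thesis using int_vertsI[OF T'(1,3) y e] no by blast
    qed
  qed (use r in auto)
  have V: "verts T = R"
  proof
    show "verts T \<subseteq> R"
    proof
      fix v assume v: "v \<in> verts T"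
      then have "v = r \<or> v \<in> B" using sub nb r(2) by blast
      then show "v \<in> R" using bR[OF v] r(1) by blast
    qed
  qed (rule T'(4))
  have "edges T = (\<lambda>y. {r, y}) ` (R \<inter> B)"
  proof
    show "edges T \<subseteq> (\<lambda>y. {r, y}) ` (R \<inter> B)"
    proof
      fix e assume e: "e \<in> edges T"
      then obtain a b where ab: "e = {a, b}" "a \<in> A" "b \<in> B"
        using T'(5) G(1) by (auto simp: complete_bipartite_def)
      then have "a \<in> R" "b \<in> R" using e T'(1) V by (auto simp: simple_graph_def)
      then have "a = r" "b \<in> R \<inter> B" using ab R(1) by blast+
      then show "e \<in> (\<lambda>y. {r, y}) ` (R \<inter> B)" using ab(1) by simp
    qed
    show "(\<lambda>y. {r, y}) ` (R \<inter> B) \<subseteq> edges T"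
    proof
      fix e assume "e \<in> (\<lambda>y. {r, y}) ` (R \<inter> B)"
      then obtain y where y: "e = {r, y}" "y \<in> R" "y \<in> B" by blast
      then have "y \<noteq> r" using r(2) AB by blast
      then show "e \<in> edges T" using sub V y(1,2) by auto
    qed
  qed
  then show ?thesis using V by simp
qed

text \<open>A vertex of \<open>T\<close> in \<open>A - {r}\<close> would be a nonterminal, hence
  internal. So \<open>r\<close> is the only vertex of \<open>T\<close> in \<open>A\<close>, and no
  vertex of \<open>B\<close> can have two neighbours.\<close>

lemma steiner_tree_int_verts_opposite:
  assumes G: "complete_bipartite G A B" "finite A" "finite B"
    and T: "steiner_tree G R T" and R: "R \<inter> A = {r}" "R \<subseteq> verts G"
    and no: "int_verts T \<inter> (A - {r}) = {}"
  shows "int_verts T \<inter> B = {}"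
proof (rule ccontr)
  assume "int_verts T \<inter> B \<noteq> {}"
  then obtain b where b: "b \<in> B" "b \<in> int_verts T" by blast
  note fin = complete_bipartite_finite_edges[OF G]
  have T': "simple_graph T" "finite (edges T)" "edges T \<subseteq> edges G" "verts T \<subseteq> verts G"
    using T finite_edges_steiner_tree[OF fin T]
    by (auto simp: steiner_tree_def tree_def subgraph_def)
  have aR: "v = r" if "v \<in> verts T" "v \<in> A" for v
    using steiner_tree_nonterminal[OF T fin _ that(1)] R(1) no that(2) by blast
  obtain u w where uw: "u \<noteq> w" "{b, u} \<in> edges T" "{b, w} \<in> edges T"
    using b(2) degree_ge_2_iff[OF T'(1,2)] by (auto simp: int_verts_def)
  then have "u \<in> A" "w \<in> A"
    using complete_bipartite_edge_sides[OF G(1) T'(3)] b(1) by blast+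
  moreover have "u \<in> verts T" "w \<in> verts T"
    using T'(1) uw(2,3) by (auto simp: simple_graph_def)
  ultimately show False using aR uw(1) by blast
qed

section \<open>Counting trees by their internal vertices\<close>

text \<open>Choosing in each tree an internal vertex from \<open>F\<close> is injective, because the
  interiors are pairwise disjoint.\<close>

lemma card_IDST_le:
  assumes "IDST G R \<T>" "finite F" "\<And>T. T \<in> \<T> \<Longrightarrow> int_verts T \<inter> F \<noteq> {}"
  shows "card \<T> \<le> card F"
proof -
  have "\<forall>T \<in> \<T>. \<exists>v. v \<in> int_verts T \<inter> F" using assms(3) by blast
  then obtain f where f: "\<And>T. T \<in> \<T> \<Longrightarrow> f T \<in> int_verts T \<inter> F" by metis
  have "inj_on f \<T>" using f assms(1) unfolding inj_on_def IDST_def by (metis IntI Int_iff empty_iff)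
  then show ?thesis using f assms(2) by (intro card_inj_on_le) auto
qed

text \<open>Here \<open>T0\<close> is the one tree that may avoid \<open>F\<close>; it is later
  instantiated with the star around the single terminal.\<close>

lemma card_IDST_le_Suc:
  assumes "IDST G R \<T>" "finite F" "\<And>T. T \<in> \<T> \<Longrightarrow> T \<noteq> T0 \<Longrightarrow> int_verts T \<inter> F \<noteq> {}"
  shows "card \<T> \<le> Suc (card F)"
proof -
  have "IDST G R (\<T> - {T0})" using assms(1) by (auto simp: IDST_def)
  then have "card (\<T> - {T0}) \<le> card F" by (rule card_IDST_le) (use assms in auto)
  then show ?thesis by (simp add: card_Diff_singleton_if split: if_splits)
qed

section \<open>Double stars and families of them\<close>

text \<open>The centres form one argument so that the map can be applied to a matching. The two
  insertions supply the central edge and allow a centre to be a terminal. If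
  \<open>X \<subseteq> {a}\<close>, the graph is a plain star around \<open>a\<close>.\<close>

definition double_star :: "'a set \<Rightarrow> 'a set \<Rightarrow> 'a \<times> 'a \<Rightarrow> 'a graph" where
  "double_star X Y = (\<lambda>(a, b). \<lparr>verts = {a, b} \<union> X \<union> Y,
     edges = {{a, y} | y. y \<in> insert b Y} \<union> {{x, b} | x. x \<in> insert a X}\<rparr>)"

lemma double_star_edge_iff:
  "{u, v} \<in> edges (double_star X Y (a, b)) \<longleftrightarrow>
     u = a \<and> v \<in> insert b Y \<or> v = a \<and> u \<in> insert b Y \<or>
     u = b \<and> v \<in> insert a X \<or> v = b \<and> u \<in> insert a X"
  by (auto simp: double_star_def doubleton_eq_iff)

text \<open>The neighbours of \<open>a\<close> are \<open>b\<close> and the terminals in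
  \<open>B\<close>, those of \<open>b\<close> are \<open>a\<close> and the terminals in
  \<open>A\<close>, and every other vertex has a single neighbour. The premises of the second claim
  make each centre a terminal or internal, so that all leaves are terminals.\<close>

lemma double_star:
  assumes G: "complete_bipartite G A B" "finite A" "finite B"
    and R: "R \<subseteq> verts G" and ab: "a \<in> A" "b \<in> B"
  shows int_verts_double_star:
      "int_verts (double_star (R \<inter> A) (R \<inter> B) (a, b)) =
         (if R \<inter> B \<subseteq> {b} then {} else {a}) \<union> (if R \<inter> A \<subseteq> {a} then {} else {b})"
        (is "int_verts ?D = ?I")
    and steiner_tree_double_star:
      "\<lbrakk>a \<in> R \<or> \<not> R \<inter> B \<subseteq> {b}; b \<in> R \<or> \<not> R \<inter> A \<subseteq> {a}\<rbrakk> \<Longrightarrow>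
         steiner_tree G R (double_star (R \<inter> A) (R \<inter> B) (a, b))"
proof -
  have AB: "A \<inter> B = {}" "verts G = A \<union> B" using G(1) by (auto simp: complete_bipartite_def)
  have V: "verts ?D = {a, b} \<union> R" using R AB by (auto simp: double_star_def)
  have E: "edges ?D \<subseteq> edges G"
    using G(1) ab by (auto simp: double_star_def complete_bipartite_def)
  have simple: "simple_graph ?D"
    unfolding simple_graph_def
  proof
    fix e assume "e \<in> edges ?D"
    then show "e \<subseteq> verts ?D \<and> card e = 2"
      using AB ab by (auto simp: double_star_def card_2_iff')
  qed
  have finE: "finite (edges ?D)"
    using complete_bipartite_finite_edges[OF G] E by (rule finite_subset[rotated])
  note edge = double_star_edge_iff[of _ _ "R \<inter> A" "R \<inter> B" a b]
  show int: "int_verts ?D = ?I"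
  proof -
    have "a \<noteq> b" using ab AB by blast
    have "2 \<le> degree ?D v \<longleftrightarrow> v \<in> ?I" for v
    proof -
      have "2 \<le> degree ?D v \<longleftrightarrow> (\<exists>u w. u \<noteq> w \<and> {v, u} \<in> edges ?D \<and> {v, w} \<in> edges ?D)"
        by (rule degree_ge_2_iff[OF simple finE])
      also have "\<dots> \<longleftrightarrow> v \<in> ?I"
      proof -
        have "v \<noteq> a \<Longrightarrow> v \<noteq> b \<Longrightarrow> {v, u} \<in> edges ?D \<Longrightarrow> {v, w} \<in> edges ?D \<Longrightarrow> u = w" for u w
          unfolding edge using AB(1) by blast
        moreover have "{a, u} \<in> edges ?D \<longleftrightarrow> u \<in> insert b (R \<inter> B)" for u
          unfolding edge using \<open>a \<noteq> b\<close> ab(1) AB(1) by blast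
        moreover have "{b, u} \<in> edges ?D \<longleftrightarrow> u \<in> insert a (R \<inter> A)" for u
          unfolding edge using \<open>a \<noteq> b\<close> ab(2) AB(1) by blast
        moreover have "v \<in> ?I \<longleftrightarrow> v = a \<and> \<not> R \<inter> B \<subseteq> {b} \<or> v = b \<and> \<not> R \<inter> A \<subseteq> {a}"
          by simp
        \<comment> \<open>With \<open>c\<close> one centre and \<open>Z\<close> the terminals on its
          side, \<open>insert c Z\<close> is the neighbourhood of the other centre, which is
          therefore internal exactly if \<open>Z\<close> has an element besides
          \<open>c\<close>.\<close>
        moreover have "\<not> Z \<subseteq> {c} \<longleftrightarrow> (\<exists>u w. u \<noteq> w \<and> u \<in> insert c Z \<and> w \<in> insert c Z)"
          for Z :: "'a set" and c by blast
        ultimately show ?thesis by metis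
      qed
      finally show ?thesis .
    qed
    moreover have "?I \<subseteq> verts ?D" using V by auto
    ultimately show ?thesis unfolding int_verts_def by blast
  qed
  show "steiner_tree G R ?D"
    if ends: "a \<in> R \<or> \<not> R \<inter> B \<subseteq> {b}" "b \<in> R \<or> \<not> R \<inter> A \<subseteq> {a}"
  proof -
    let ?r = "{(x, y). {x, y} \<in> edges ?D}"
    have "connected_graph ?D"
    proof (rule connected_graphI_root[OF simple, of a])
      show "a \<in> verts ?D" using V by simp
      fix v assume "v \<in> verts ?D"
      then consider "v = a" | "v \<in> insert b (R \<inter> B)" | "v \<in> R \<inter> A" using V R AB by auto
      then show "(a, v) \<in> ?r\<^sup>*"
      proof cases
        case 2
        then show ?thesis by (intro r_into_rtrancl) (auto simp: edge)
      next
        case 3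
        then have "(a, b) \<in> ?r" "(b, v) \<in> ?r" by (auto simp: edge)
        then show ?thesis by (meson rtrancl.rtrancl_into_rtrancl r_into_rtrancl)
      qed simp
    qed
    moreover have "\<nexists>p. cycle ?D p"
    proof
      assume "\<exists>p. cycle ?D p"
      then obtain x y z where xyz: "distinct [x, y, z]" "{x, y, z} \<subseteq> int_verts ?D"
        using cycle_three_int_verts[OF simple finE] by blast
      have "int_verts ?D \<subseteq> {a, b}" by (auto simp: int)
      then show False using xyz by auto
    qed
    moreover have "leaves ?D \<subseteq> R"
    proof
      fix v assume "v \<in> leaves ?D"
      then have v: "v \<in> verts ?D" "v \<notin> int_verts ?D" by (auto simp: leaves_def int_verts_def)
      then have "v \<in> {a, b} \<union> R" "v \<notin> ?I" unfolding V int by blast+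
      then show "v \<in> R" using ends by (auto split: if_splits)
    qed
    ultimately show ?thesis
      using simple V E AB ab R by (auto simp: steiner_tree_def tree_def subgraph_def)
  qed
qed

text \<open>Disjoint interiors do not separate trees without internal vertices, and equal trees
  would be counted once. Hence only one pair, \<open>p0\<close>, may give an empty interior.\<close>

lemma IDST_double_stars:
  assumes G: "complete_bipartite G A B" "finite A" "finite B"
    and R: "R \<subseteq> verts G" and P: "P \<subseteq> A \<times> B"
    and ends: "\<And>a b. (a, b) \<in> P \<Longrightarrow> (a \<in> R \<or> \<not> R \<inter> B \<subseteq> {b}) \<and> (b \<in> R \<or> \<not> R \<inter> A \<subseteq> {a})"
    and disj: "\<And>p q. \<lbrakk>p \<in> P; q \<in> P; p \<noteq> q\<rbrakk> \<Longrightarrow>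
      int_verts (double_star (R \<inter> A) (R \<inter> B) p) \<inter> int_verts (double_star (R \<inter> A) (R \<inter> B) q) = {}"
    and nonempty: "\<And>p. \<lbrakk>p \<in> P; p \<noteq> p0\<rbrakk> \<Longrightarrow> int_verts (double_star (R \<inter> A) (R \<inter> B) p) \<noteq> {}"
  shows "\<exists>\<T>. IDST G R \<T> \<and> card \<T> = card P"
proof -
  let ?D = "double_star (R \<inter> A) (R \<inter> B)"
  have "inj_on ?D P"
  proof
    fix p q assume pq: "p \<in> P" "q \<in> P" "?D p = ?D q"
    \<comment> \<open>If \<open>p \<noteq> q\<close>, the common tree has an interior disjoint from
      itself, hence empty, which forces both pairs to be \<open>p0\<close>.\<close>
    show "p = q" by (rule ccontr) (use pq disj[of p q] nonempty[of p] nonempty[of q] in auto)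
  qed
  then have "card (?D ` P) = card P" by (rule card_image)
  moreover have "finite P" using P G(2,3) by (auto intro: finite_subset)
  moreover have "steiner_tree G R (?D p)" if "p \<in> P" for p
    using that P ends[of "fst p" "snd p"] steiner_tree_double_star[OF G R, of "fst p" "snd p"]
    by auto
  moreover have "int_verts (?D p) \<inter> int_verts (?D q) = {}" if "p \<in> P" "q \<in> P" "?D p \<noteq> ?D q" for p q
    using that disj[of p q] by blast
  ultimately have "IDST G R (?D ` P)" unfolding IDST_def by blast
  then show ?thesis using \<open>card (?D ` P) = card P\<close> by blast
qed

text \<open>A matching is encoded as a set of pairs on which both projections are injective.\<close>

lemma ex_matching:
  assumes "finite X" "finite Y" "k \<le> card X" "k \<le> card Y"
  shows "\<exists>P \<subseteq> X \<times> Y. card P = k \<and> inj_on fst P \<and> inj_on snd P"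
proof -
  obtain X' where X': "X' \<subseteq> X" "card X' = k" "finite X'"
    using assms(3) by (rule obtain_subset_with_card_n)
  obtain Y' where Y': "Y' \<subseteq> Y" "card Y' = k" "finite Y'"
    using assms(4) by (rule obtain_subset_with_card_n)
  obtain h where h: "bij_betw h X' Y'"
    using finite_same_card_bij[OF X'(3) Y'(3)] X'(2) Y'(2) by auto
  let ?P = "(\<lambda>x. (x, h x)) ` X'"
  have "?P \<subseteq> X \<times> Y" using h X'(1) Y'(1) by (auto simp: bij_betw_def)
  moreover have "card ?P = k" using X'(2) by (simp add: card_image inj_on_def)
  moreover have "inj_on fst ?P" "inj_on snd ?P" using h by (auto simp: inj_on_def bij_betw_def)
  ultimately show ?thesis by blast
qed

section \<open>The maximum sizes in the three cases\<close>

text \<open>With a terminal \<open>r\<close> fixed as first centre, the double star is a star around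
  \<open>b\<close> whose leaves are the terminals. Its only internal vertex is \<open>b\<close>, so
  one tree arises for each \<open>b \<in> B\<close>.\<close>

lemma max_IDST_size_one_side:
  assumes G: "complete_bipartite G A B" "finite A" "finite B"
    and R: "R \<subseteq> A" "card R \<ge> 2"
  shows "max_IDST_size G R (card B)"
proof -
  have AB: "A \<inter> B = {}" "verts G = A \<union> B" using G(1) by (auto simp: complete_bipartite_def)
  have eq: "R \<inter> A = R" "R \<inter> B = {}" using R AB by auto
  have RG: "R \<subseteq> verts G" using R AB by auto
  obtain r where r: "r \<in> R" using R(2) by fastforce
  have nsub: "\<not> R \<subseteq> {r}" using R(2) card_mono[of "{r}" R] by auto
  let ?D = "double_star (R \<inter> A) (R \<inter> B)"
  have int: "int_verts (?D (r, b)) = {b}" if "b \<in> B" for b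
    using int_verts_double_star[OF G RG _ that, of r] r R(1) nsub eq by auto
  have "\<exists>\<T>. IDST G R \<T> \<and> card \<T> = card ({r} \<times> B)"
    \<comment> \<open>Every interior is \<open>{b}\<close>, so the exceptional pair can be
      arbitrary.\<close>
    by (rule IDST_double_stars[OF G RG, where ?p0.0 = undefined])
      (use r R(1) nsub eq int in auto)
  moreover have "card \<T> \<le> card B" if "IDST G R \<T>" for \<T>
  proof (rule card_IDST_le[OF that G(3)])
    fix T assume "T \<in> \<T>"
    then have "steiner_tree G R T" using that by (auto simp: IDST_def)
    then show "int_verts T \<inter> B \<noteq> {}"
      using steiner_tree_int_verts_meet[OF G] R(2) eq by simp
  qed
  ultimately show ?thesis by (auto simp: max_IDST_size_def card_cartesian_product_singleton)
qed

text \<open>The family is the star at \<open>r\<close> plus double stars matched off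
  \<open>A - {r}\<close>. If each side holds one terminal, the true value is the size of the smaller
  side; the formula yields this only under \<open>card A \<le> card B\<close>, and the opposite case
  follows by exchanging the sides.\<close>

lemma max_IDST_size_single:
  assumes G: "complete_bipartite G A B" "finite A" "finite B"
    and R: "R \<subseteq> verts G" "card (R \<inter> A) = 1" "card (R \<inter> B) > 0"
      "card (R \<inter> B) = 1 \<longrightarrow> card A \<le> card B"
  shows "max_IDST_size G R (min (card A) (card B + 1))"
proof -
  obtain r where r: "R \<inter> A = {r}" using R(2) by (auto simp: card_1_singleton_iff)
  have "R \<inter> B \<noteq> {}" using R(3) by (metis card.empty less_irrefl)
  then obtain s where s: "s \<in> R \<inter> B" by blast
  have AB: "A \<inter> B = {}" "verts G = A \<union> B" using G(1) by (auto simp: complete_bipartite_def)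
  have rA: "r \<in> R" "r \<in> A" using r by auto
  have cA: "card A = Suc (card (A - {r}))"
    using card_Suc_Diff1[OF G(2) rA(2)] by simp
  let ?D = "double_star (R \<inter> A) (R \<inter> B)"
  \<comment> \<open>A first centre \<open>a \<noteq> r\<close> is a nonterminal and must be
    internal, so its partner \<open>b\<close> must not be the only terminal in
    \<open>B\<close>.\<close>
  let ?Y = "{b \<in> B. \<not> R \<inter> B \<subseteq> {b}}"
  let ?k = "min (card A) (card B + 1)"
  \<comment> \<open>If \<open>R \<inter> B = {s}\<close>, then \<open>?Y\<close> loses
    \<open>s\<close>, and \<open>card A \<le> card B\<close> compensates for the loss. Otherwise
    \<open>?Y\<close> is all of \<open>B\<close>.\<close>
  have kY: "?k - 1 \<le> card ?Y"
  proof (cases "card (R \<inter> B) = 1")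
    case True
    then have "R \<inter> B = {s}" using s by (metis card_1_singletonE singletonD)
    then have "?Y = B - {s}" by auto
    then show ?thesis using True R(4) G(3) s by auto
  next
    case False
    have "\<not> R \<inter> B \<subseteq> {b}" for b
      using card_mono[of "{b}" "R \<inter> B"] False R(3) by auto
    then show ?thesis by auto
  qed
  have "?k - 1 \<le> card (A - {r})" using cA by simp
  then obtain Q where Q: "Q \<subseteq> (A - {r}) \<times> ?Y" "card Q = ?k - 1" "inj_on fst Q" "inj_on snd Q"
    using ex_matching[of "A - {r}" ?Y "?k - 1"] kY G(2,3) by auto
  \<comment> \<open>As \<open>r\<close> is the only terminal in \<open>A\<close>, the pair
    \<open>(r, s)\<close> yields the star around \<open>r\<close> that is exceptional in the upper
    bound. It adds one tree without using an internal vertex of \<open>B\<close> or of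
    \<open>A - {r}\<close>.\<close>
  have intr: "int_verts (?D (r, s)) \<subseteq> {r}"
    using int_verts_double_star[OF G R(1) rA(2), of s] s r by auto
  have intQ: "int_verts (?D (a, b)) = {a, b}" if "(a, b) \<in> Q" for a b
  proof -
    have "a \<in> A" "a \<noteq> r" "b \<in> B" "\<not> R \<inter> B \<subseteq> {b}" using that Q(1) by auto
    then show ?thesis using int_verts_double_star[OF G R(1), of a b] r by auto
  qed
  have disj: "int_verts (?D p) \<inter> int_verts (?D q) = {}" if pq: "p \<in> Q" "q \<in> Q" "p \<noteq> q" for p q
  proof -
    have "fst p \<noteq> fst q" "snd p \<noteq> snd q" using pq Q(3,4) by (auto simp: inj_on_def)
    moreover have "fst p \<in> A" "fst q \<in> A" "snd p \<in> B" "snd q \<in> B" using pq Q(1) by auto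
    ultimately show ?thesis
      using intQ[of "fst p" "snd p"] intQ[of "fst q" "snd q"] pq AB by auto
  qed
  have disj0: "int_verts (?D (r, s)) \<inter> int_verts (?D p) = {}" if "p \<in> Q" for p
  proof -
    have "fst p \<in> A - {r}" "snd p \<in> B" using that Q(1) by auto
    then have "fst p \<noteq> r" "snd p \<noteq> r" using AB(1) rA(2) by auto
    then show ?thesis using intr intQ[of "fst p" "snd p"] that by auto
  qed
  have "\<exists>\<T>. IDST G R \<T> \<and> card \<T> = card (insert (r, s) Q)"
  \<comment> \<open>If \<open>R \<inter> B = {s}\<close>, the tree of \<open>(r, s)\<close> is a
    single edge without internal vertices, hence this choice of the exceptional pair.\<close>
  proof (rule IDST_double_stars[OF G R(1), where ?p0.0 = "(r, s)"])
    show "insert (r, s) Q \<subseteq> A \<times> B" using Q(1) rA s by auto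
    show "(a \<in> R \<or> \<not> R \<inter> B \<subseteq> {b}) \<and> (b \<in> R \<or> \<not> R \<inter> A \<subseteq> {a})"
      if "(a, b) \<in> insert (r, s) Q" for a b using that Q(1) rA s r by auto
    show "int_verts (?D p) \<inter> int_verts (?D q) = {}"
      if "p \<in> insert (r, s) Q" "q \<in> insert (r, s) Q" "p \<noteq> q" for p q
      using that disj disj0 by (metis Int_commute insertE)
    show "int_verts (?D p) \<noteq> {}" if "p \<in> insert (r, s) Q" "p \<noteq> (r, s)" for p
      using that intQ[of "fst p" "snd p"] by auto
  qed
  moreover have "card (insert (r, s) Q) = ?k"
  proof -
    have "finite Q" using Q(1) G(2,3) by (auto intro: finite_subset)
    moreover have "(r, s) \<notin> Q" using Q(1) by auto
    ultimately show ?thesis using Q(2) cA by simp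
  qed
  moreover have "card \<T> \<le> ?k" if idst: "IDST G R \<T>" for \<T>
  proof -
    \<comment> \<open>The same graph is the only possible exception to both counts, over
      \<open>B\<close> and over \<open>A - {r}\<close>; each bound is thus one more than the size of
      the set counted.\<close>
    have star: "T = \<lparr>verts = R, edges = (\<lambda>y. {r, y}) ` (R \<inter> B)\<rparr>"
      if "T \<in> \<T>" "int_verts T \<inter> B = {} \<or> int_verts T \<inter> (A - {r}) = {}" for T
      using that idst steiner_tree_star[OF G _ r R(1)]
        steiner_tree_int_verts_opposite[OF G _ r R(1)] by (auto simp only: IDST_def)
    have "card \<T> \<le> Suc (card B)" by (rule card_IDST_le_Suc[OF idst G(3)]) (use star in blast)
    moreover have "card \<T> \<le> Suc (card (A - {r}))"
      by (rule card_IDST_le_Suc[OF idst]) (use star G(2) in blast)+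
    ultimately show ?thesis using cA by simp
  qed
  ultimately show ?thesis by (auto simp: max_IDST_size_def)
qed

text \<open>Two terminals on each side make both centres of every double star internal, so each tree
  uses one vertex per side and the centres form a matching. Conversely, every Steiner tree has an
  internal vertex on each side.\<close>

lemma max_IDST_size_both_sides:
  assumes G: "complete_bipartite G A B" "finite A" "finite B"
    and R: "R \<subseteq> verts G" "card (R \<inter> A) > 1" "card (R \<inter> B) > 1"
  shows "max_IDST_size G R (min (card A) (card B))"
proof -
  have AB: "A \<inter> B = {}" using G(1) by (auto simp: complete_bipartite_def)
  let ?D = "double_star (R \<inter> A) (R \<inter> B)"
  have nsub: "\<not> R \<inter> A \<subseteq> {v}" "\<not> R \<inter> B \<subseteq> {v}" for v
    using card_mono[of "{v}" "R \<inter> A"] card_mono[of "{v}" "R \<inter> B"] R(2,3) by auto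
  obtain P where P: "P \<subseteq> A \<times> B" "card P = min (card A) (card B)" "inj_on fst P" "inj_on snd P"
    using ex_matching[OF G(2,3)] by (metis min.cobounded1 min.cobounded2)
  have int: "int_verts (?D p) = {fst p, snd p}" if "p \<in> P" for p
    using that P(1) nsub int_verts_double_star[OF G R(1), of "fst p" "snd p"] by auto
  have "\<exists>\<T>. IDST G R \<T> \<and> card \<T> = card P"
  proof (rule IDST_double_stars[OF G R(1) P(1), where ?p0.0 = undefined])
    show "int_verts (?D p) \<inter> int_verts (?D q) = {}" if pq: "p \<in> P" "q \<in> P" "p \<noteq> q" for p q
    proof -
      have "fst p \<noteq> fst q" "snd p \<noteq> snd q" using pq P(3,4) by (auto simp: inj_on_def)
      moreover have "fst p \<in> A" "fst q \<in> A" "snd p \<in> B" "snd q \<in> B" using pq P(1) by auto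
      ultimately show ?thesis using int pq AB by auto
    qed
  qed (use nsub int in auto)
  moreover have "card \<T> \<le> min (card A) (card B)" if idst: "IDST G R \<T>" for \<T>
  proof -
    have st: "steiner_tree G R T" if "T \<in> \<T>" for T using that idst by (auto simp: IDST_def)
    have "card \<T> \<le> card A"
      by (rule card_IDST_le[OF idst G(2)])
        (use st steiner_tree_int_verts_meet[OF complete_bipartite_commute[OF G(1)] G(3,2)] R(3) in blast)
    moreover have "card \<T> \<le> card B"
      by (rule card_IDST_le[OF idst G(3)]) (use st steiner_tree_int_verts_meet[OF G] R(2) in blast)
    ultimately show ?thesis by simp
  qed
  ultimately show ?thesis using P(2) by (auto simp: max_IDST_size_def)
qed

theorem theorem3p12:
  fixes G :: "'a graph" and A B R :: "'a set"
  assumes "finite A" and "finite B"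
    and "complete_bipartite G A B"
    and "R \<subseteq> verts G" and "card R \<ge> 2"
  shows "(R \<subseteq> A \<longrightarrow> max_IDST_size G R (card B)) \<and>
         (R \<subseteq> B \<longrightarrow> max_IDST_size G R (card A)) \<and>
         (card (R \<inter> A) = 1 \<and> card (R \<inter> B) > 0 \<and>
            (card (R \<inter> B) = 1 \<longrightarrow> card A \<le> card B) \<longrightarrow>
            max_IDST_size G R (min (card A) (card B + 1))) \<and>
         (card (R \<inter> B) = 1 \<and> card (R \<inter> A) > 0 \<and>
            (card (R \<inter> A) = 1 \<longrightarrow> card B \<le> card A) \<longrightarrow>
            max_IDST_size G R (min (card B) (card A + 1))) \<and>
         (card (R \<inter> A) > 1 \<and> card (R \<inter> B) > 1 \<longrightarrow>
            max_IDST_size G R (min (card A) (card B)))"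
  \<comment> \<open>The mirrored clauses are the same lemmas with \<open>A\<close> and
    \<open>B\<close> exchanged.\<close>
  using max_IDST_size_one_side[OF assms(3,1,2)] max_IDST_size_single[OF assms(3,1,2,4)]
    max_IDST_size_both_sides[OF assms(3,1,2,4)]
    max_IDST_size_one_side[OF complete_bipartite_commute[OF assms(3)] assms(2,1)]
    max_IDST_size_single[OF complete_bipartite_commute[OF assms(3)] assms(2,1,4)]
    assms(5)
  by blast

end
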